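(* Let $f:\Lambda\to\Lambda'$ be a map of action operads. 1. The groups $\mathrm{Ker}\,f_n=\{x\in\Lambda(n): f(x)=e_n\}$ form an action operad $\mathrm{Ker}\,f$ for which the inclusion $\mathrm{Ker}\,f\hookrightarrow\Lambda$ is a map of action operads. 2. The groups $\mathrm{Im}\,f_n=\{f(x): x\in\Lambda(n)\}$ form an action operad $\mathrm{Im}\,f$ for which the inclusion $\mathrm{Im}\,f\hookrightarrow\Lambda'$ is a map of action operads.
   Context: $\mathbb N\ni 0$; $e_n$ is the identity of the $n$th group; permutations compose as functions. A (non-symmetric) operad $O$ in sets: sets $O(n)$ ($n\in\mathbb N$), $\mathrm{id}\in O(1)$, functions $\mu:O(n)\times O(k_1)\times\cdots\times O(k_n)\to O(k_1+\cdots+k_n)$, unital ($\mu(\mathrm{id};x)=x=\mu(x;\mathrm{id},\dots,\mathrm{id})$) and associative in the usual sense; maps preserve $\mathrm{id}$ and $\mu$. The operad $\Sigma$ of symmetric groups has $\mu(\sigma;\tau_1,\dots,\tau_n)=\delta(\sigma)\cdot\beta(\tau_1,\dots,\tau_n)$, with $\beta$ the block sum of the permutations $\tau_i\in\Sigma_{k_i}$ and $\delta(\sigma)=\delta_{n;k_1,\dots,k_n}(\sigma)$ sending $k_1+\cdots+k_{i-1}+a$ ($1\le a\le k_i$) to $(\sum_{\sigma(i')<\sigma(i)}k_{i'})+a$. An action operad $(\Lambda,\pi)$: an operad $\Lambda$ in sets with a group structure on each $\Lambda(n)$ and a map of operads $\pi:\Lambda\to\Sigma$ whose components are group homomorphisms,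 such that, writing $g(i)=\pi_n(g)(i)$, $\mu(g';f_1',\dots,f_n')\mu(g;f_1,\dots,f_n)=\mu(g'g;f'_{g(1)}f_1,\dots,f'_{g(n)}f_n)$ for $g,g'\in\Lambda(n)$, $f_i\in\Lambda(k_i)$, $f_i'\in\Lambda(k_{g^{-1}(i)})$. A map of action operads is a map of operads $f:\Lambda\to\Lambda'$ with $\pi^{\Lambda'}f=\pi^{\Lambda}$ and each $f_n$ a group homomorphism. *)

theory Defs
  imports "HOL-Algebra.Sym_Groups"
begin

section \<open>Non-symmetric operads in sets\<close>

text \<open>
  The sets of an operad all live in one type and need not be disjoint, so the composition takes
  the list of arities as an explicit argument: \<open>mu P [k\<^sub>1, \<dots>, k\<^sub>n] x [y\<^sub>1, \<dots>, y\<^sub>n]\<close> is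
  \<open>\<mu>(x; y\<^sub>1, \<dots>, y\<^sub>n)\<close> for \<open>x \<in> O(n)\<close> and \<open>y\<^sub>i \<in> O(k\<^sub>i)\<close>. Nothing is assumed about its values at
  other arguments. Likewise, a map of operads is a family of functions indexed by arity.
\<close>

record 'a operad_data =
  ops :: "nat \<Rightarrow> 'a set"
  ident :: 'a
  mu :: "nat list \<Rightarrow> 'a \<Rightarrow> 'a list \<Rightarrow> 'a"

definition args :: "(nat \<Rightarrow> 'a set) \<Rightarrow> nat list \<Rightarrow> 'a list \<Rightarrow> bool"
  where "args X ks ys \<longleftrightarrow> list_all2 (\<lambda>k y. y \<in> X k) ks ys"

text \<open>
  In the associativity law, \<open>lss ! i\<close> lists the arities of the operations \<open>zss ! i\<close> that are
  plugged into \<open>ys ! i\<close>.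
\<close>

locale operad =
  fixes P :: "'a operad_data"
  assumes ident_closed: "ident P \<in> ops P 1"
    and mu_closed: "\<And>ks x ys. x \<in> ops P (length ks) \<Longrightarrow> args (ops P) ks ys \<Longrightarrow>
          mu P ks x ys \<in> ops P (sum_list ks)"
    and mu_ident_left: "\<And>n x. x \<in> ops P n \<Longrightarrow> mu P [n] (ident P) [x] = x"
    and mu_ident_right: "\<And>n x. x \<in> ops P n \<Longrightarrow>
          mu P (replicate n 1) x (replicate n (ident P)) = x"
    and mu_assoc: "\<And>ks lss x ys zss.
          x \<in> ops P (length ks) \<Longrightarrow> args (ops P) ks ys \<Longrightarrow>
          map length lss = ks \<Longrightarrow> list_all2 (args (ops P)) lss zss \<Longrightarrow>
          mu P (concat lss) (mu P ks x ys) (concat zss) =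
          mu P (map sum_list lss) x
            (map (\<lambda>i. mu P (lss ! i) (ys ! i) (zss ! i)) [0..<length ks])"

locale operad_map =
  fixes P :: "'a operad_data" and Q :: "'b operad_data" and f :: "nat \<Rightarrow> 'a \<Rightarrow> 'b"
  assumes map_closed: "\<And>n x. x \<in> ops P n \<Longrightarrow> f n x \<in> ops Q n"
    and map_ident: "f 1 (ident P) = ident Q"
    and map_mu: "\<And>ks x ys. x \<in> ops P (length ks) \<Longrightarrow> args (ops P) ks ys \<Longrightarrow>
          f (sum_list ks) (mu P ks x ys) = mu Q ks (f (length ks) x) (map2 f ks ys)"


section \<open>The operad of symmetric groups\<close>

text \<open>
  Permutations act on \<open>{1..n}\<close> and blocks are numbered from 1, whereas lists are indexed from 0;
  hence the shifts \<open>ks ! (i - 1)\<close>. For \<open>1 \<le> m \<le> k\<^sub>1 + \<dots> + k\<^sub>n\<close>, write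
  \<open>m = k\<^sub>1 + \<dots> + k\<^bsub>i-1\<^esub> + a\<close> with \<open>1 \<le> a \<le> k\<^sub>i\<close>; then \<open>i = block_index ks m\<close> and
  \<open>a = block_pos ks m\<close>.
\<close>

definition block_start :: "nat list \<Rightarrow> nat \<Rightarrow> nat"
  where "block_start ks i = sum_list (take (i - 1) ks)"

definition block_index :: "nat list \<Rightarrow> nat \<Rightarrow> nat"
  where "block_index ks m = (LEAST i. m \<le> sum_list (take i ks))"

definition block_pos :: "nat list \<Rightarrow> nat \<Rightarrow> nat"
  where "block_pos ks m = m - block_start ks (block_index ks m)"

definition block_sum :: "nat list \<Rightarrow> (nat \<Rightarrow> nat) list \<Rightarrow> nat \<Rightarrow> nat"
  where "block_sum ks \<tau>s m =
    (if m \<in> {1..sum_list ks}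
     then let i = block_index ks m in block_start ks i + (\<tau>s ! (i - 1)) (block_pos ks m)
     else m)"

definition block_perm :: "nat list \<Rightarrow> (nat \<Rightarrow> nat) \<Rightarrow> nat \<Rightarrow> nat"
  where "block_perm ks \<sigma> m =
    (if m \<in> {1..sum_list ks}
     then let i = block_index ks m
          in (\<Sum>i' \<in> {i' \<in> {1..length ks}. \<sigma> i' < \<sigma> i}. ks ! (i' - 1)) + block_pos ks m
     else m)"

lemma block_index_eq:
  assumes "i \<in> {1..length ks}" "a \<in> {1..ks ! (i - 1)}"
  shows "block_index ks (block_start ks i + a) = i"
  unfolding block_index_def block_start_def
proof (rule Least_equality)
  have "take i ks = take (i - 1) ks @ [ks ! (i - 1)]"
    using assms(1) take_Suc_conv_app_nth[of "i - 1" ks] by auto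
  then show "sum_list (take (i - 1) ks) + a \<le> sum_list (take i ks)"
    using assms(2) by auto
next
  fix j assume j: "sum_list (take (i - 1) ks) + a \<le> sum_list (take j ks)"
  show "i \<le> j"
  proof (rule ccontr)
    assume "\<not> i \<le> j"
    then have "min j (i - 1) = j" by simp
    then have "take j ks = take j (take (i - 1) ks)" by (simp only: take_take)
    then have "sum_list (take (i - 1) ks) =
        sum_list (take j ks) + sum_list (drop j (take (i - 1) ks))"
      by (metis append_take_drop_id sum_list_append)
    with j assms(2) show False by auto
  qed
qed

lemma block_start_le:
  assumes "i \<in> {1..length ks}" "a \<in> {1..ks ! (i - 1)}"
  shows "block_start ks i + a \<in> {1..sum_list ks}"
proof -
  have "take i ks = take (i - 1) ks @ [ks ! (i - 1)]"
    using assms(1) take_Suc_conv_app_nth[of "i - 1" ks] by auto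
  then have "sum_list ks = sum_list (take (i - 1) ks) + ks ! (i - 1) + sum_list (drop i ks)"
    by (metis append_take_drop_id sum_list_append sum_list.Cons sum_list.Nil add_0_right)
  with assms show ?thesis by (auto simp: block_start_def)
qed

lemma block_sum_apply:
  assumes "i \<in> {1..length ks}" "a \<in> {1..ks ! (i - 1)}"
  shows "block_sum ks \<tau>s (block_start ks i + a) = block_start ks i + (\<tau>s ! (i - 1)) a"
  using block_start_le[OF assms] block_index_eq[OF assms]
  by (simp add: block_sum_def block_pos_def Let_def)

lemma block_perm_apply:
  assumes "i \<in> {1..length ks}" "a \<in> {1..ks ! (i - 1)}"
  shows "block_perm ks \<sigma> (block_start ks i + a) =
    (\<Sum>i' \<in> {i' \<in> {1..length ks}. \<sigma> i' < \<sigma> i}. ks ! (i' - 1)) + a"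
  using block_start_le[OF assms] block_index_eq[OF assms]
  by (simp add: block_perm_def block_pos_def Let_def)

definition Sigma_operad :: "(nat \<Rightarrow> nat) operad_data"
  where "Sigma_operad = \<lparr>
    ops = (\<lambda>n. carrier (sym_group n)),
    ident = id,
    mu = (\<lambda>ks \<sigma> \<tau>s. block_perm ks \<sigma> \<circ> block_sum ks \<tau>s) \<rparr>"


section \<open>Action operads\<close>

record 'a action_operad_data =
  grp :: "nat \<Rightarrow> 'a monoid"
  unit_op :: 'a
  comp_op :: "nat list \<Rightarrow> 'a \<Rightarrow> 'a list \<Rightarrow> 'a"
  proj :: "nat \<Rightarrow> 'a \<Rightarrow> nat \<Rightarrow> nat"

definition operad_of :: "'a action_operad_data \<Rightarrow> 'a operad_data"
  where "operad_of L =
    \<lparr> ops = (\<lambda>n. carrier (grp L n)), ident = unit_op L, mu = comp_op L \<rparr>"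

text \<open>
  In \<open>interchange\<close> the arity of \<open>f'\<^sub>i\<close> is \<open>k\<^bsub>g\<^sup>-\<^sup>1(i)\<^esub>\<close>; the corresponding arity list is \<open>ks'\<close>.
\<close>

locale action_operad =
  fixes L :: "'a action_operad_data"
  assumes operad: "operad (operad_of L)"
    and group: "\<And>n. group (grp L n)"
    and proj_operad_map: "operad_map (operad_of L) Sigma_operad (proj L)"
    and proj_hom: "\<And>n. proj L n \<in> hom (grp L n) (sym_group n)"
    and interchange: "\<And>n ks ks' g g' fs fs'.
          g \<in> carrier (grp L n) \<Longrightarrow> g' \<in> carrier (grp L n) \<Longrightarrow> length ks = n \<Longrightarrow>
          ks' = map (\<lambda>i. ks ! (inv' (proj L n g) i - 1)) [1..<Suc n] \<Longrightarrow>
          args (\<lambda>k. carrier (grp L k)) ks fs \<Longrightarrow>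
          args (\<lambda>k. carrier (grp L k)) ks' fs' \<Longrightarrow>
          comp_op L ks' g' fs' \<otimes>\<^bsub>grp L (sum_list ks)\<^esub> comp_op L ks g fs =
          comp_op L ks (g' \<otimes>\<^bsub>grp L n\<^esub> g)
            (map (\<lambda>i. fs' ! (proj L n g i - 1) \<otimes>\<^bsub>grp L (ks ! (i - 1))\<^esub> fs ! (i - 1))
              [1..<Suc n])"

locale action_operad_map =
  fixes L :: "'a action_operad_data" and L' :: "'b action_operad_data"
    and f :: "nat \<Rightarrow> 'a \<Rightarrow> 'b"
  assumes operad_map: "operad_map (operad_of L) (operad_of L') f"
    and map_proj: "\<And>n x. x \<in> carrier (grp L n) \<Longrightarrow> proj L' n (f n x) = proj L n x"
    and map_hom: "\<And>n. f n \<in> hom (grp L n) (grp L' n)"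

text \<open>Restricting the carriers keeps all the remaining structure.\<close>

definition restrict_action_operad ::
    "'a action_operad_data \<Rightarrow> (nat \<Rightarrow> 'a set) \<Rightarrow> 'a action_operad_data"
  where "restrict_action_operad L S = L\<lparr> grp := (\<lambda>n. (grp L n)\<lparr> carrier := S n \<rparr>) \<rparr>"

definition Ker_action_operad ::
    "'a action_operad_data \<Rightarrow> 'b action_operad_data \<Rightarrow> (nat \<Rightarrow> 'a \<Rightarrow> 'b) \<Rightarrow> 'a action_operad_data"
  where "Ker_action_operad L L' f =
    restrict_action_operad L (\<lambda>n. kernel (grp L n) (grp L' n) (f n))"

definition Im_action_operad ::
    "'a action_operad_data \<Rightarrow> 'b action_operad_data \<Rightarrow> (nat \<Rightarrow> 'a \<Rightarrow> 'b) \<Rightarrow> 'b action_operad_data"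
  where "Im_action_operad L L' f =
    restrict_action_operad L' (\<lambda>n. f n ` carrier (grp L n))"

end

theory Submission
  imports Defs
begin

text \<open>
  Subgroups that contain \<open>id\<close> and are closed under \<open>\<mu>\<close> inherit all the axioms. For images this
  closure is immediate. For kernels one needs \<open>id = e\<^sub>1\<close> and \<open>\<mu>(e\<^sub>n; e\<^bsub>k\<^sub>1\<^esub>, \<dots>, e\<^bsub>k\<^sub>n\<^esub>) = e\<close> in
  the target; by the interchange law both \<open>id\<close> and \<open>\<mu>(e\<^sub>n; e\<^bsub>k\<^sub>1\<^esub>, \<dots>, e\<^bsub>k\<^sub>n\<^esub>)\<close> are idempotent, hence
  trivial.
\<close>

lemma args_mono: "args X ks ys \<Longrightarrow> (\<And>k. X k \<subseteq> Y k) \<Longrightarrow> args Y ks ys"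
  unfolding args_def by (erule list_all2_mono) blast

lemma (in group) idempotent_eq_one: "x \<in> carrier G \<Longrightarrow> x \<otimes> x = x \<Longrightarrow> x = \<one>"
  using l_cancel_one by blast

text \<open>Every axiom is either a closure condition, supplied by \<open>sub\<close>,
  \<open>unit\<close> and \<open>comp\<close>, or an equation between operations that
  \<open>L\<close> and its restriction share. Such an equation holds for all elements of the
  carriers of \<open>L\<close>, hence for those in \<open>S\<close>; only the membership hypotheses
  have to be carried from \<open>S\<close> to the larger carriers.\<close>

lemma (in action_operad) restrict_action_operad:
  assumes sub: "\<And>n. subgroup (S n) (grp L n)"
    and unit: "unit_op L \<in> S 1"
    and comp: "\<And>ks x ys. x \<in> S (length ks) \<Longrightarrow> args S ks ys \<Longrightarrow> comp_op L ks x ys \<in> S (sum_list ks)"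
  shows "action_operad (restrict_action_operad L S)" (is "action_operad ?R")
    and "action_operad_map (restrict_action_operad L S) L (\<lambda>n x. x)"
proof -
  have S: "S n \<subseteq> carrier (grp L n)" for n
    using sub subgroup.subset by blast
  have args: "args (\<lambda>n. carrier (grp L n)) ks ys" if "args S ks ys" for ks ys
    using args_mono[OF that S] .
  interpret O: operad "operad_of L" by (rule operad)
  interpret M: operad_map "operad_of L" Sigma_operad "proj L" by (rule proj_operad_map)
  note [simp] = restrict_action_operad_def operad_of_def
  show "action_operad ?R"
  proof (intro action_operad.intro operad.intro operad_map.intro)
    show "ident (operad_of ?R) \<in> ops (operad_of ?R) 1"
      using unit by simp
    show "mu (operad_of ?R) ks x ys \<in> ops (operad_of ?R) (sum_list ks)"
      if "x \<in> ops (operad_of ?R) (length ks)" "args (ops (operad_of ?R)) ks ys" for ks x ys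
      using that comp by simp
    show "mu (operad_of ?R) [n] (ident (operad_of ?R)) [x] = x"
      if "x \<in> ops (operad_of ?R) n" for n x
      using that O.mu_ident_left[of x n] S by auto
    show "mu (operad_of ?R) (replicate n 1) x (replicate n (ident (operad_of ?R))) = x"
      if "x \<in> ops (operad_of ?R) n" for n x
      using that O.mu_ident_right[of x n] S by auto
    show "mu (operad_of ?R) (concat lss) (mu (operad_of ?R) ks x ys) (concat zss) =
        mu (operad_of ?R) (map sum_list lss) x
          (map (\<lambda>i. mu (operad_of ?R) (lss ! i) (ys ! i) (zss ! i)) [0..<length ks])"
      if "x \<in> ops (operad_of ?R) (length ks)" "args (ops (operad_of ?R)) ks ys"
        "map length lss = ks" "list_all2 (args (ops (operad_of ?R))) lss zss" for ks lss x ys zss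
    proof -
      have "list_all2 (args (\<lambda>n. carrier (grp L n))) lss zss"
        using that(4) by (auto elim!: list_all2_mono intro: args)
      then show ?thesis
        using that S args O.mu_assoc[of x ks ys lss zss] by auto
    qed
    show "group (grp ?R n)" for n
      using subgroup.subgroup_is_group[OF sub group] by simp
    show "proj ?R n x \<in> ops Sigma_operad n" if "x \<in> ops (operad_of ?R) n" for n x
      using that M.map_closed[of x n] S by auto
    show "proj ?R 1 (ident (operad_of ?R)) = ident Sigma_operad"
      using M.map_ident by simp
    show "proj ?R (sum_list ks) (mu (operad_of ?R) ks x ys) =
        mu Sigma_operad ks (proj ?R (length ks) x) (map2 (proj ?R) ks ys)"
      if "x \<in> ops (operad_of ?R) (length ks)" "args (ops (operad_of ?R)) ks ys" for ks x ys
      using that S args M.map_mu[of x ks ys] by auto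
    show "proj ?R n \<in> hom (grp ?R n) (sym_group n)" for n
      using proj_hom[of n] S[of n] by (auto simp: hom_def)
    show "comp_op ?R ks' g' fs' \<otimes>\<^bsub>grp ?R (sum_list ks)\<^esub> comp_op ?R ks g fs =
        comp_op ?R ks (g' \<otimes>\<^bsub>grp ?R n\<^esub> g)
          (map (\<lambda>i. fs' ! (proj ?R n g i - 1) \<otimes>\<^bsub>grp ?R (ks ! (i - 1))\<^esub> fs ! (i - 1))
            [1..<Suc n])"
      if "g \<in> carrier (grp ?R n)" "g' \<in> carrier (grp ?R n)" "length ks = n"
        "ks' = map (\<lambda>i. ks ! (inv' (proj ?R n g) i - 1)) [1..<Suc n]"
        "args (\<lambda>k. carrier (grp ?R k)) ks fs" "args (\<lambda>k. carrier (grp ?R k)) ks' fs'"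
      for n ks ks' g g' fs fs'
    proof -
      \<comment> \<open>The restriction keeps the products and \<open>proj\<close> of
        \<open>L\<close>, so \<open>ks'\<close> is the same list for both structures.\<close>
      have "g \<in> carrier (grp L n)" "g' \<in> carrier (grp L n)"
        using that(1,2) S by auto
      moreover have "args (\<lambda>k. carrier (grp L k)) ks fs" "args (\<lambda>k. carrier (grp L k)) ks' fs'"
        using that(5,6) by (auto intro: args)
      ultimately show ?thesis
        using interchange[of g n g' ks ks' fs fs'] that(3,4) by simp
    qed
  qed
  show "action_operad_map ?R L (\<lambda>n x. x)"
  proof
    show "x \<in> ops (operad_of L) n" if "x \<in> ops (operad_of ?R) n" for n x
      using that S by auto
    show "mu (operad_of ?R) ks x ys = mu (operad_of L) ks x (map2 (\<lambda>n x. x) ks ys)"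
      if "args (ops (operad_of ?R)) ks ys" for ks x ys
    proof -
      \<comment> \<open>\<open>map2\<close> truncates to the shorter list; \<open>args\<close>
        forces the lengths to agree, so nothing of \<open>ys\<close> is lost.\<close>
      have "map2 (\<lambda>n x. x) ks ys = ys"
        using that by (auto simp: args_def list_all2_conv_all_nth intro!: nth_equalityI)
      then show ?thesis by simp
    qed
    show "(\<lambda>x. x) \<in> hom (grp ?R n) (grp L n)" for n
      using S[of n] by (auto simp: hom_def)
  qed auto
qed

text \<open>This is what makes \<open>interchange\<close> usable at a group unit: neither the
  arities nor the arguments get permuted.\<close>

lemma (in action_operad) proj_one: "proj L n \<one>\<^bsub>grp L n\<^esub> = id"
proof -
  have "proj L n \<one>\<^bsub>grp L n\<^esub> = \<one>\<^bsub>sym_group n\<^esub>"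
    using hom_one[OF proj_hom group sym_group_is_group] .
  then show ?thesis by (simp add: sym_group_one)
qed

text \<open>Evaluate the product of \<open>mu(id; e_1)\<close> and \<open>mu(id; id)\<close> in two
  ways. By the left unit law it is \<open>e_1 id = id\<close>. By \<open>interchange\<close> it is
  \<open>mu(id id; e_1 id) = mu(id id; id)\<close>, which the right unit law turns into
  \<open>id id\<close>. So \<open>id\<close> is idempotent in a group.\<close>

lemma (in action_operad) unit_op_eq_one: "unit_op L = \<one>\<^bsub>grp L 1\<^esub>"
proof -
  interpret O: operad "operad_of L" by (rule operad)
  interpret M: operad_map "operad_of L" Sigma_operad "proj L" by (rule proj_operad_map)
  interpret G: group "grp L 1" by (rule group)
  let ?u = "unit_op L"
  have u: "?u \<in> carrier (grp L 1)"
    using O.ident_closed by (simp add: operad_of_def)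
  \<comment> \<open>With this permutation the arity list \<open>ks'\<close> of
    \<open>interchange\<close> is again \<open>[1]\<close>.\<close>
  have p: "proj L 1 ?u = id"
    using M.map_ident by (simp add: operad_of_def Sigma_operad_def)
  have left: "comp_op L [1] ?u [x] = x" and right: "comp_op L [1] x [?u] = x"
    if "x \<in> carrier (grp L 1)" for x
    using that O.mu_ident_left[of x 1] O.mu_ident_right[of x 1] by (auto simp: operad_of_def)
  have "comp_op L [1] ?u [\<one>\<^bsub>grp L 1\<^esub>] \<otimes>\<^bsub>grp L 1\<^esub> comp_op L [1] ?u [?u] =
      comp_op L [1] (?u \<otimes>\<^bsub>grp L 1\<^esub> ?u) [\<one>\<^bsub>grp L 1\<^esub> \<otimes>\<^bsub>grp L 1\<^esub> ?u]"
    using interchange[of ?u 1 ?u "[1]" "[1]" "[?u]" "[\<one>\<^bsub>grp L 1\<^esub>]"] u p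
      G.one_closed
    by (simp add: args_def)
  then have "?u \<otimes>\<^bsub>grp L 1\<^esub> ?u = ?u"
    using u left right G.one_closed G.l_one[OF u] G.m_closed[OF u u] by simp
  then show ?thesis
    using u G.idempotent_eq_one by blast
qed

text \<open>Multiplying the composite of units by itself, \<open>interchange\<close> multiplies
  units slot by slot and returns the same composite.\<close>

lemma (in action_operad) comp_op_ones:
  "comp_op L ks \<one>\<^bsub>grp L (length ks)\<^esub> (map (\<lambda>k. \<one>\<^bsub>grp L k\<^esub>) ks) = \<one>\<^bsub>grp L (sum_list ks)\<^esub>"
proof -
  interpret O: operad "operad_of L" by (rule operad)
  interpret G: group "grp L k" for k by (rule group)
  let ?n = "length ks" and ?es = "map (\<lambda>k. \<one>\<^bsub>grp L k\<^esub>) ks"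
  let ?e = "comp_op L ks \<one>\<^bsub>grp L ?n\<^esub> ?es"
  have es: "args (\<lambda>k. carrier (grp L k)) ks ?es"
    by (simp add: args_def list_all2_conv_all_nth)
  \<comment> \<open>The permuted arity list demanded by \<open>interchange\<close>, here for the
    identity permutation. Position \<open>j\<close> of \<open>[1..<Suc ?n]\<close> holds
    \<open>j + 1\<close>, and the shift by 1 undoes this.\<close>
  have ks: "ks = map (\<lambda>i. ks ! (inv' (proj L ?n \<one>\<^bsub>grp L ?n\<^esub>) i - 1)) [1..<Suc ?n]"
    by (rule nth_equalityI) (simp_all add: proj_one del: upt_Suc)
  have "map (\<lambda>i. ?es ! (proj L ?n \<one>\<^bsub>grp L ?n\<^esub> i - 1) \<otimes>\<^bsub>grp L (ks ! (i - 1))\<^esub> ?es ! (i - 1))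
      [1..<Suc ?n] = ?es"
    by (rule nth_equalityI) (simp_all add: proj_one del: upt_Suc)
  then have "?e \<otimes>\<^bsub>grp L (sum_list ks)\<^esub> ?e = ?e"
    using interchange[OF G.one_closed G.one_closed refl ks es es] by simp
  moreover have "?e \<in> carrier (grp L (sum_list ks))"
    using O.mu_closed[of "\<one>\<^bsub>grp L ?n\<^esub>" ks ?es] es by (simp add: operad_of_def)
  ultimately show ?thesis
    using G.idempotent_eq_one by blast
qed

theorem proposition6p4:
  fixes L :: "'a action_operad_data" and L' :: "'b action_operad_data"
    and f :: "nat \<Rightarrow> 'a \<Rightarrow> 'b"
  assumes "action_operad L" and "action_operad L'"
    and "action_operad_map L L' f"
  shows "(action_operad (Ker_action_operad L L' f) \<and>
         action_operad_map (Ker_action_operad L L' f) L (\<lambda>n x. x)) \<and>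
         (action_operad (Im_action_operad L L' f) \<and>
         action_operad_map (Im_action_operad L L' f) L' (\<lambda>n x. x))"
proof -
  interpret L: action_operad L by fact
  interpret L': action_operad L' by fact
  interpret F: action_operad_map L L' f by fact
  interpret O: operad "operad_of L" by (rule L.operad)
  interpret M: operad_map "operad_of L" "operad_of L'" f by (rule F.operad_map)
  interpret H: group_hom "grp L n" "grp L' n" "f n" for n
    by (simp add: group_hom_def group_hom_axioms_def L.group L'.group F.map_hom)
  define K where "K n = kernel (grp L n) (grp L' n) (f n)" for n
  define I where "I n = f n ` carrier (grp L n)" for n
  have unit: "unit_op L \<in> carrier (grp L 1)" "f 1 (unit_op L) = unit_op L'"
    using O.ident_closed M.map_ident by (simp_all add: operad_of_def)
  have comp: "comp_op L ks x ys \<in> carrier (grp L (sum_list ks))"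
    "f (sum_list ks) (comp_op L ks x ys) = comp_op L' ks (f (length ks) x) (map2 f ks ys)"
    if "x \<in> carrier (grp L (length ks))" "args (\<lambda>n. carrier (grp L n)) ks ys" for ks x ys
    using that O.mu_closed[of x ks ys] M.map_mu[of x ks ys] by (simp_all add: operad_of_def)

  have unit_K: "unit_op L \<in> K 1"
    using unit L'.unit_op_eq_one by (simp add: K_def kernel_def)
  have comp_K: "comp_op L ks x ys \<in> K (sum_list ks)"
    if "x \<in> K (length ks)" "args K ks ys" for ks x ys
  proof -
    have x: "x \<in> carrier (grp L (length ks))" "f (length ks) x = \<one>\<^bsub>grp L' (length ks)\<^esub>"
      using that(1) by (auto simp: K_def kernel_def)
    have ys: "args (\<lambda>n. carrier (grp L n)) ks ys"
      using that(2) by (rule args_mono) (auto simp: K_def kernel_def)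
    \<comment> \<open>So \<open>f\<close> sends the composite to a composite of units in
      \<open>L'\<close>, which \<open>comp_op_ones\<close> evaluates.\<close>
    have "map2 f ks ys = map (\<lambda>k. \<one>\<^bsub>grp L' k\<^esub>) ks"
      using that(2) by (auto simp: args_def list_all2_conv_all_nth K_def kernel_def
          intro!: nth_equalityI)
    then show ?thesis
      using comp[OF x(1) ys] x(2) L'.comp_op_ones[of ks] by (simp add: K_def kernel_def)
  qed

  have unit_I: "unit_op L' \<in> I 1"
    using unit by (force simp: I_def)
  have comp_I: "comp_op L' ks x ys \<in> I (sum_list ks)"
    if xI: "x \<in> I (length ks)" and ysI: "args I ks ys" for ks x ys
  proof -
    obtain x0 where x0: "x0 \<in> carrier (grp L (length ks))" "x = f (length ks) x0"
      using xI by (auto simp: I_def)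
    have len: "length ys = length ks"
      and "\<forall>i<length ks. \<exists>y. y \<in> carrier (grp L (ks ! i)) \<and> ys ! i = f (ks ! i) y"
      using ysI by (auto simp: args_def list_all2_conv_all_nth I_def)
    \<comment> \<open>Preimages are chosen by position and not by element: \<open>f\<close> depends
      on the arity, and one element may occur in \<open>ys\<close> at several arities.\<close>
    then obtain y where y: "\<And>i. i < length ks \<Longrightarrow>
        y i \<in> carrier (grp L (ks ! i)) \<and> ys ! i = f (ks ! i) (y i)"
      by metis
    define ys0 where "ys0 = map y [0..<length ks]"
    have ys0: "args (\<lambda>n. carrier (grp L n)) ks ys0" "map2 f ks ys0 = ys"
      using y len by (auto simp: ys0_def args_def list_all2_conv_all_nth intro!: nth_equalityI)
    \<comment> \<open>The composite of the chosen preimages is itself a preimage of the composite,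
      since \<open>f\<close> preserves composition.\<close>
    show ?thesis
      using comp[OF x0(1) ys0(1)] ys0(2) x0(2) by (force simp: I_def)
  qed

  have sub_K: "subgroup (K n) (grp L n)" and sub_I: "subgroup (I n) (grp L' n)" for n
    unfolding K_def I_def by (rule H.subgroup_kernel, rule H.img_is_subgroup)
  show ?thesis
    using L.restrict_action_operad[OF sub_K unit_K comp_K]
      L'.restrict_action_operad[OF sub_I unit_I comp_I]
    by (simp add: Ker_action_operad_def Im_action_operad_def K_def[abs_def] I_def[abs_def])
qed

end
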